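(* Let $(p,q)=(2,3)$ and $U\ge1$ an integer. The graph $G(U)$ is connected, and its diameter is at most $\dfrac{\log^2 U}{\log 2\,\log 3}$.
   Context: A strictly chained $(2,3)$-ary partition of $U$ is a set of distinct positive integers of the form $2^a3^b$ summing to $U$ which form a chain for divisibility (each part divides every larger part). $\Omega(U)$ is the set of these. $G(U)$ is the symmetric graph on $\Omega(U)$ in which $\varpi$ and $\varpi'$ are adjacent iff one is obtained from the other by one of the following transitions. Fix $\varpi$ and an exponent $b$ such that some part of $\varpi$ has the form $2^a3^b$, and let $2^a3^b$ be such a part with $a$ maximal. (A) If $2^{a-1}3^b$ is also a part, remove both $2^a3^b$ and $2^{a-1}3^b$ and add the part $2^{a-1}3^{b+1}$. (B) If $2^{a-1}3^b$ is not a part, let $C$ be the maximal (possibly empty) set of parts of the form $2^{a-i}3^b$ with $i$ running contiguously from $2$ up to some $n$; put $c=a-2$ if $C$ is empty and $c=a-n-1$ otherwise. If $c\ge0$ and $\varpi$ has no part of the form $2^{c+1}3^d$ with $d<b$, multiply every part of $C$ by $3$, remove $2^a3^b$, and add the two parts $2^c3^b$ and $2^c3^{b+1}$. These transitions produce partitions in $\Omega(U)$. *)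

theory Defs
  imports Complex_Main "Graph_Theory.Graph_Theory"
begin

definition chained_partitions :: "nat \<Rightarrow> nat set set" where
  "chained_partitions U = {P. finite P \<and> (\<forall>x\<in>P. \<exists>a b. x = 2 ^ a * 3 ^ b) \<and>
     (\<forall>x\<in>P. \<forall>y\<in>P. x < y \<longrightarrow> x dvd y) \<and> \<Sum>P = U}"

definition top_exponent :: "nat set \<Rightarrow> nat \<Rightarrow> nat \<Rightarrow> bool" where
  "top_exponent P b a \<longleftrightarrow> 2 ^ a * 3 ^ b \<in> P \<and> (\<forall>a'. 2 ^ a' * 3 ^ b \<in> P \<longrightarrow> a' \<le> a)"

text \<open>A number of the form \<open>2\<^bsup>a-1\<^esup>3\<^bsup>b\<^esup>\<close> can be a part only if \<open>a \<ge> 1\<close>; the conditions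
  \<open>a \<ge> 1\<close> below guard against truncated subtraction.\<close>

definition transition_A :: "nat \<Rightarrow> nat set \<Rightarrow> nat set \<Rightarrow> bool" where
  "transition_A b P Q \<longleftrightarrow> (\<exists>a. top_exponent P b a \<and> a \<ge> 1 \<and> 2 ^ (a - 1) * 3 ^ b \<in> P \<and>
     Q = (P - {2 ^ a * 3 ^ b, 2 ^ (a - 1) * 3 ^ b}) \<union> {2 ^ (a - 1) * 3 ^ (b + 1)})"

text \<open>In transition (B) the value \<open>n = 1\<close> encodes that \<open>C\<close> is empty, so that \<open>c = a - n - 1\<close> in
  both cases. The equation \<open>a = c + n + 1\<close> over the naturals expresses this together with
  \<open>c \<ge> 0\<close>; it also yields \<open>i < a\<close> for all \<open>i \<le> n\<close>. The condition that \<open>2\<^bsup>c\<^esup>3\<^bsup>b\<^esup>\<close> is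
  not a part says that the contiguous run \<open>C\<close> is maximal.\<close>

definition transition_B :: "nat \<Rightarrow> nat set \<Rightarrow> nat set \<Rightarrow> bool" where
  "transition_B b P Q \<longleftrightarrow> (\<exists>a n c C.
     top_exponent P b a \<and> \<not> (a \<ge> 1 \<and> 2 ^ (a - 1) * 3 ^ b \<in> P) \<and>
     n \<ge> 1 \<and> a = c + n + 1 \<and>
     C = (\<lambda>i. 2 ^ (a - i) * 3 ^ b) ` {2..n} \<and> C \<subseteq> P \<and> 2 ^ c * 3 ^ b \<notin> P \<and>
     (\<forall>d<b. 2 ^ (c + 1) * 3 ^ d \<notin> P) \<and>
     Q = (P - C - {2 ^ a * 3 ^ b}) \<union> (\<lambda>x. 3 * x) ` C \<union> {2 ^ c * 3 ^ b, 2 ^ c * 3 ^ (b + 1)})"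

definition transition :: "nat set \<Rightarrow> nat set \<Rightarrow> bool" where
  "transition P Q \<longleftrightarrow> (\<exists>b. transition_A b P Q \<or> transition_B b P Q)"

text \<open>Both ends of an edge are required to be chained partitions. This is not redundant: the
  hypotheses of (B) hold for the partition \<open>{4, 12}\<close> of 16 with \<open>b = 1\<close>, \<open>a = 2\<close>, \<open>c = 0\<close>, but
  the result \<open>{3, 4, 9}\<close> is not a chain, so it is not a vertex and gives no edge.\<close>

definition partition_graph :: "nat \<Rightarrow> nat set pair_pre_digraph" where
  "partition_graph U = \<lparr> pverts = chained_partitions U,
     parcs = {(P, Q). P \<in> chained_partitions U \<and> Q \<in> chained_partitions U \<and>
                      (transition P Q \<or> transition Q P)} \<rparr>"

text \<open>With unit arc weights, \<open>wf_digraph.\<mu>\<close> is the usual graph distance (\<open>\<infinity>\<close> if there is no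
  walk).\<close>

definition graph_diameter :: "('a, 'b) pre_digraph \<Rightarrow> ereal" where
  "graph_diameter G = (SUP u\<in>verts G. SUP v\<in>verts G. wf_digraph.\<mu> G (\<lambda>_. 1) u v)"

lemma pair_sym_digraph_partition_graph: "pair_sym_digraph (partition_graph U)"
  by unfold_locales (auto simp: partition_graph_def symmetric_def sym_def)

lemma wf_digraph_partition_graph: "wf_digraph (with_proj (partition_graph U))"
  by unfold_locales (auto simp: partition_graph_def)

end

theory Submission
  imports Defs "HOL-Library.Nat_Bijection"
begin

text \<open>Identify a part \<open>2 ^ a * 3 ^ b\<close> with the point \<open>(a, b)\<close>, so that a chained partition is a finite chain
  in the product order. In the top row \<open>b + 1 \<ge> 1\<close> nothing lies above, so the leftmost part
  \<open>(m, b + 1)\<close> can always be moved down by undoing a transition: (A) if \<open>(m, b)\<close> is not a part,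
  (B) otherwise. A row whose parts have \<open>a \<le> M\<close> is cleared in at most \<open>(M + 3) / 2\<close> moves, and
  clearing all rows leads to the binary expansion of \<open>U\<close>. Since \<open>2 ^ M * 3 ^ b \<le> U\<close>, summing over the rows
  bounds the distance to the binary expansion by half the claimed diameter, except for
  \<open>U = 3\<close>.\<close>

section \<open>Partitions as sets of exponent pairs\<close>

definition part :: "nat \<times> nat \<Rightarrow> nat" where
  "part p = 2 ^ fst p * 3 ^ snd p"

definition staircase :: "(nat \<times> nat) set \<Rightarrow> bool" where
  "staircase S \<longleftrightarrow> finite S \<and>
     (\<forall>(a, b)\<in>S. \<forall>(c, d)\<in>S. (a \<le> c \<and> b \<le> d) \<or> (c \<le> a \<and> d \<le> b))"

definition staircases :: "nat \<Rightarrow> (nat \<times> nat) set set" where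
  "staircases U = {S. staircase S \<and> sum part S = U}"

lemma part_pos: "part p > 0"
  by (simp add: part_def)

text \<open>2 and 3 are consecutive, so powers of 2 and of 3 are coprime and the two prime factors
  can be compared separately. Divisibility of parts thus becomes the product order on exponent
  pairs.\<close>

lemma part_dvd_iff: "part (a, b) dvd part (c, d) \<longleftrightarrow> a \<le> c \<and> b \<le> d"
proof
  assume dvd: "part (a, b) dvd part (c, d)"
  have "(2::nat) ^ a dvd 2 ^ c * 3 ^ d" "(3::nat) ^ b dvd 2 ^ c * 3 ^ d"
    using dvd by (auto simp: part_def intro: dvd_trans dvd_mult_left dvd_mult_right)
  moreover have "coprime ((2::nat) ^ a) (3 ^ d)" "coprime ((3::nat) ^ b) (2 ^ c)"
    using coprime_Suc_right_nat[of 2] coprime_Suc_left_nat[of 2]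
    by (simp_all add: numeral_3_eq_3)
  ultimately have "(2::nat) ^ a dvd 2 ^ c" "(3::nat) ^ b dvd 3 ^ d"
    by (simp_all add: coprime_dvd_mult_left_iff coprime_dvd_mult_right_iff)
  then show "a \<le> c \<and> b \<le> d"
    by (auto dest: power_dvd_imp_le)
qed (simp add: part_def mult_dvd_mono le_imp_power_dvd)

lemma inj_part: "inj part"
proof (rule injI)
  fix p q assume "part p = part q"
  then show "p = q"
    using part_dvd_iff[of "fst p" "snd p" "fst q" "snd q"]
      part_dvd_iff[of "fst q" "snd q" "fst p" "snd p"]
    by (simp add: prod_eq_iff)
qed

lemma part_mem_image: "2 ^ a * 3 ^ b \<in> part ` S \<longleftrightarrow> (a, b) \<in> S"
  using inj_image_mem_iff[OF inj_part, of "(a, b)" S] by (simp add: part_def)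

lemma sum_part_image: "\<Sum>(part ` S) = sum part S"
  by (simp add: sum.reindex inj_on_subset[OF inj_part])

lemma sum_part_row: "sum part (A \<times> {b}) = (\<Sum>i\<in>A. 2 ^ i) * 3 ^ b"
proof -
  have "A \<times> {b} = (\<lambda>i. (i, b)) ` A" by auto
  then show ?thesis
    by (simp add: sum.reindex inj_on_def part_def sum_distrib_right)
qed

text \<open>This dictionary lets everything below argue with points of the grid; \<open>part\<close>
  is applied only when a transition or a vertex of the graph is needed.\<close>

lemma chained_partitions_eq: "chained_partitions U = (`) part ` staircases U"
proof (rule set_eqI, rule iffI)
  fix P assume P: "P \<in> chained_partitions U"
  define S where "S = part -` P"
  have *: "P = part ` S"
  proof -
    have "P \<subseteq> range part"
    proof
      fix x assume "x \<in> P"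
      then obtain a b where "x = 2 ^ a * 3 ^ b"
        using P unfolding chained_partitions_def by blast
      then have "x = part (a, b)" by (simp add: part_def)
      then show "x \<in> range part" by blast
    qed
    then show ?thesis unfolding S_def by blast
  qed
  have "finite S" using P unfolding S_def chained_partitions_def
    by (auto intro: finite_vimageI inj_part)
  moreover have "(a \<le> c \<and> b \<le> d) \<or> (c \<le> a \<and> d \<le> b)" if "(a, b) \<in> S" "(c, d) \<in> S" for a b c d
  proof -
    have "part (a, b) dvd part (c, d) \<or> part (c, d) dvd part (a, b)"
      using P that unfolding S_def chained_partitions_def
      by (cases "part (a, b)" "part (c, d)" rule: linorder_cases) auto
    then show ?thesis by (simp add: part_dvd_iff)
  qed
  ultimately have "staircase S" unfolding staircase_def by fast
  moreover have "sum part S = U"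
    using P sum_part_image[of S] unfolding chained_partitions_def by (simp add: *)
  ultimately show "P \<in> (`) part ` staircases U" using * unfolding staircases_def by blast
next
  fix P assume "P \<in> (`) part ` staircases U"
  then obtain S where S: "staircase S" "sum part S = U" "P = part ` S"
    unfolding staircases_def by blast
  have "x dvd y" if xy: "x \<in> P" "y \<in> P" "x < y" for x y
  proof -
    obtain p q where "p \<in> S" "q \<in> S" "x = part p" "y = part q"
      using xy(1,2) unfolding S(3) by blast
    then obtain a b c d where *: "(a, b) \<in> S" "(c, d) \<in> S" "x = part (a, b)" "y = part (c, d)"
      by (cases p, cases q) blast
    then have "(a \<le> c \<and> b \<le> d) \<or> (c \<le> a \<and> d \<le> b)"
      using S(1) unfolding staircase_def by blast
    then have "x dvd y \<or> y dvd x" unfolding *(3,4) part_dvd_iff .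
    then show ?thesis using xy(3) part_pos[of "(a, b)"] *(3) by (auto dest: dvd_imp_le)
  qed
  moreover have "\<forall>x\<in>P. \<exists>a b. x = 2 ^ a * 3 ^ b"
    using S(3) by (auto simp: part_def)
  moreover have "finite P" using S unfolding staircase_def by simp
  moreover have "\<Sum>P = U" using S by (simp add: sum_part_image)
  ultimately show "P \<in> chained_partitions U" unfolding chained_partitions_def by blast
qed

lemma part_le:
  assumes "S \<in> staircases U" "(a, b) \<in> S"
  shows "2 ^ a * 3 ^ b \<le> U"
  using assms member_le_sum[of "(a, b)" S part]
  unfolding staircases_def staircase_def by (auto simp: part_def)

section \<open>Undoing a transition in the top row\<close>

text \<open>Rests on \<open>2 ^ m * 3 = 2 ^ m + 2 ^ Suc m\<close>. The two new points fit into the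
  chain because the old parts in rows up to \<open>b\<close> end at column \<open>m\<close>, while
  the rest of the top row starts at column \<open>m + 1\<close> or later.\<close>

lemma undo_transition_A:
  assumes S: "S \<in> staircases U" and mem: "(m, Suc b) \<in> S"
    and rows_le: "\<forall>(x, y)\<in>S. y \<le> Suc b"
    and row_ge: "\<forall>x. (x, Suc b) \<in> S \<longrightarrow> m \<le> x"
    and nmem: "(m, b) \<notin> S"
  defines "T \<equiv> insert (m, b) (insert (Suc m, b) (S - {(m, Suc b)}))"
  shows "T \<in> staircases U" "transition_A b (part ` T) (part ` S)"
proof -
  have rows: "\<And>x y. (x, y) \<in> S \<Longrightarrow> y \<le> Suc b" using rows_le by blast
  have min: "\<And>x. (x, Suc b) \<in> S \<Longrightarrow> m \<le> x" using row_ge by blast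
  have fin: "finite S" and chain: "\<And>a b c d. (a, b) \<in> S \<Longrightarrow> (c, d) \<in> S \<Longrightarrow>
      (a \<le> c \<and> b \<le> d) \<or> (c \<le> a \<and> d \<le> b)" and sum: "sum part S = U"
    using S unfolding staircases_def staircase_def by fast+
  \<comment> \<open>Comparability with \<open>(m, Suc b)\<close> gives the bound on the column; it
    is strict in row \<open>b\<close> because \<open>(m, b)\<close> is not a part.\<close>
  have below: "x \<le> m \<and> (y = b \<longrightarrow> x < m)" if "(x, y) \<in> S" "y \<le> b" for x y
    using chain[OF that(1) mem] that nmem by (auto simp: le_less)
  have cmp: "(x \<le> m \<and> y \<le> b) \<or> (m < x \<and> y = Suc b)"
    if "(x, y) \<in> S" "(x, y) \<noteq> (m, Suc b)" for x y
    using below[OF that(1)] rows[OF that(1)] min[of x] that by (cases "y \<le> b") (auto simp: le_Suc_eq le_less)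
  have "(x \<le> z \<and> y \<le> w) \<or> (z \<le> x \<and> w \<le> y)"
    if "(x, y) \<in> T" "(z, w) \<in> T" for x y z w
  proof -
    have new: "m \<le> x \<and> x \<le> Suc m \<and> y = b" if "(x, y) \<in> {(m, b), (Suc m, b)}" for x y
      using that by auto
    have "(x, y) \<in> {(m, b), (Suc m, b)} \<or> (x, y) \<in> S \<and> (x, y) \<noteq> (m, Suc b)"
      "(z, w) \<in> {(m, b), (Suc m, b)} \<or> (z, w) \<in> S \<and> (z, w) \<noteq> (m, Suc b)"
      using that unfolding T_def by blast+
    then show ?thesis
    proof (elim disjE conjE)
      assume "(x, y) \<in> {(m, b), (Suc m, b)}" "(z, w) \<in> {(m, b), (Suc m, b)}"
      from new[OF this(1)] new[OF this(2)] show ?thesis by linarith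
    next
      assume "(x, y) \<in> {(m, b), (Suc m, b)}" "(z, w) \<in> S" "(z, w) \<noteq> (m, Suc b)"
      from new[OF this(1)] cmp[OF this(2,3)] show ?thesis by linarith
    next
      assume "(x, y) \<in> S" "(x, y) \<noteq> (m, Suc b)" "(z, w) \<in> {(m, b), (Suc m, b)}"
      from cmp[OF this(1,2)] new[OF this(3)] show ?thesis by linarith
    next
      assume "(x, y) \<in> S" "(z, w) \<in> S"
      then show ?thesis by (rule chain)
    qed
  qed
  moreover have "finite T" unfolding T_def using fin by simp
  ultimately have "staircase T" unfolding staircase_def by blast
  moreover have "sum part T = U"
  proof -
    have "(Suc m, b) \<notin> S" using below[of "Suc m" b] by auto
    then have "sum part T = part (m, b) + part (Suc m, b) + sum part (S - {(m, Suc b)})"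
      unfolding T_def using fin nmem by (subst sum.insert; simp)+
    also have "\<dots> = part (m, Suc b) + sum part (S - {(m, Suc b)})"
      by (simp add: part_def)
    also have "\<dots> = U" using sum.remove[OF fin mem, of part] sum by simp
    finally show ?thesis .
  qed
  ultimately show "T \<in> staircases U" unfolding staircases_def by blast
  have "S = (T - {(Suc m, b), (m, b)}) \<union> {(m, Suc b)}"
    using below[of "Suc m" b] nmem mem unfolding T_def by auto
  then have "part ` S = part ` ((T - {(Suc m, b), (m, b)}) \<union> {(m, Suc b)})" by simp
  then have "part ` S = (part ` T - {part (Suc m, b), part (m, b)}) \<union> {part (m, Suc b)}"
    by (simp add: image_Un image_set_diff[OF inj_part])
  then have "part ` S = (part ` T - {2 ^ Suc m * 3 ^ b, 2 ^ (Suc m - 1) * 3 ^ b})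
      \<union> {2 ^ (Suc m - 1) * 3 ^ (b + 1)}"
    by (simp add: part_def)
  moreover have "top_exponent (part ` T) b (Suc m)"
    unfolding top_exponent_def part_mem_image T_def using below by fastforce
  moreover have "2 ^ (Suc m - 1) * 3 ^ b \<in> part ` T"
    unfolding part_mem_image T_def by simp
  ultimately show "transition_A b (part ` T) (part ` S)"
    unfolding transition_A_def by (intro exI[of _ "Suc m"]) simp
qed

text \<open>Here \<open>(c, b)\<close> is occupied, so the maximal run of length \<open>n\<close>
  starting at \<open>(c, Suc b)\<close> is moved at once: its tail drops to row \<open>b\<close>,
  while its head and \<open>(c, b)\<close> are traded for \<open>(c + n + 1, b)\<close>. The
  \<open>n\<close> is that of \<open>transition_B\<close>, with
  \<open>a = c + n + 1\<close>.\<close>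

lemma undo_transition_B:
  assumes S: "S \<in> staircases U" and mem: "(c, Suc b) \<in> S"
    and rows_le: "\<forall>(x, y)\<in>S. y \<le> Suc b"
    and row_ge: "\<forall>x. (x, Suc b) \<in> S \<longrightarrow> c \<le> x"
    and memb: "(c, b) \<in> S" and n: "n \<ge> 1"
    and run: "\<forall>i\<in>{c..<c + n}. (i, Suc b) \<in> S" and stop: "(c + n, Suc b) \<notin> S"
  defines "T \<equiv> (S - {(c, b)} - {c..<c + n} \<times> {Suc b}) \<union> {c<..<c + n} \<times> {b} \<union> {(c + n + 1, b)}"
  shows "T \<in> staircases U" "transition_B b (part ` T) (part ` S)"
proof -
  have rows: "\<And>x y. (x, y) \<in> S \<Longrightarrow> y \<le> Suc b" using rows_le by blast
  have min: "\<And>x. (x, Suc b) \<in> S \<Longrightarrow> c \<le> x" using row_ge by blast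
  have fin: "finite S" and chain: "\<And>a b c d. (a, b) \<in> S \<Longrightarrow> (c, d) \<in> S \<Longrightarrow>
      (a \<le> c \<and> b \<le> d) \<or> (c \<le> a \<and> d \<le> b)" and sum: "sum part S = U"
    using S unfolding staircases_def staircase_def by fast+
  have below: "x \<le> c" if "(x, y) \<in> S" "y \<le> b" for x y
    using chain[OF that(1) mem] that by auto
  \<comment> \<open>Since the run stops before column \<open>c + n\<close>, the remaining top-row
    parts start at column \<open>c + n + 1\<close> or later, which leaves room for the new point
    \<open>(c + n + 1, b)\<close> below them.\<close>
  have rest: "(x \<le> c \<and> y \<le> b) \<or> (c + n < x \<and> y = Suc b)"
    if "(x, y) \<in> S - {(c, b)} - {c..<c + n} \<times> {Suc b}" for x y
  proof (cases "y \<le> b")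
    case True
    then show ?thesis using below that by blast
  next
    case False
    then have y: "y = Suc b" using rows[of x y] that by auto
    then have "c \<le> x" "x \<noteq> c + n" using min[of x] stop that by auto
    then show ?thesis using that y by force
  qed
  have new: "c < x \<and> x \<le> c + n + 1 \<and> y = b"
    if "(x, y) \<in> {c<..<c + n} \<times> {b} \<union> {(c + n + 1, b)}" for x y
    using that n by auto
  have "(x \<le> z \<and> y \<le> w) \<or> (z \<le> x \<and> w \<le> y)"
    if "(x, y) \<in> T" "(z, w) \<in> T" for x y z w
  proof -
    have "(x, y) \<in> S - {(c, b)} - {c..<c + n} \<times> {Suc b}
        \<or> (x, y) \<in> {c<..<c + n} \<times> {b} \<union> {(c + n + 1, b)}"
      "(z, w) \<in> S - {(c, b)} - {c..<c + n} \<times> {Suc b}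
        \<or> (z, w) \<in> {c<..<c + n} \<times> {b} \<union> {(c + n + 1, b)}"
      using that unfolding T_def by blast+
    then show ?thesis
    proof (elim disjE)
      assume "(x, y) \<in> S - {(c, b)} - {c..<c + n} \<times> {Suc b}"
        "(z, w) \<in> S - {(c, b)} - {c..<c + n} \<times> {Suc b}"
      then show ?thesis using chain by blast
    next
      assume "(x, y) \<in> S - {(c, b)} - {c..<c + n} \<times> {Suc b}"
        "(z, w) \<in> {c<..<c + n} \<times> {b} \<union> {(c + n + 1, b)}"
      from rest[OF this(1)] new[OF this(2)] show ?thesis by linarith
    next
      assume "(x, y) \<in> {c<..<c + n} \<times> {b} \<union> {(c + n + 1, b)}"
        "(z, w) \<in> S - {(c, b)} - {c..<c + n} \<times> {Suc b}"
      from new[OF this(1)] rest[OF this(2)] show ?thesis by linarith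
    next
      assume "(x, y) \<in> {c<..<c + n} \<times> {b} \<union> {(c + n + 1, b)}"
        "(z, w) \<in> {c<..<c + n} \<times> {b} \<union> {(c + n + 1, b)}"
      from new[OF this(1)] new[OF this(2)] show ?thesis by linarith
    qed
  qed
  moreover have "finite T" unfolding T_def using fin by simp
  ultimately have "staircase T" unfolding staircase_def by blast
  moreover have "sum part T = U"
  proof -
    define R where "R = S - {(c, b)} - {c..<c + n} \<times> {Suc b}"
    have finR: "finite R" using fin by (simp add: R_def)
    have "{(c, b)} \<union> {c..<c + n} \<times> {Suc b} \<subseteq> S" using memb run by auto
    then have Sdec: "S = R \<union> ({(c, b)} \<union> {c..<c + n} \<times> {Suc b})" unfolding R_def by blast
    have Rdisj: "R \<inter> ({c<..<c + n} \<times> {b} \<union> {(c + n + 1, b)}) = {}"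
    proof (intro equals0I, elim IntE, clarify)
      fix x y assume "(x, y) \<in> R" "(x, y) \<in> {c<..<c + n} \<times> {b} \<union> {(c + n + 1, b)}"
      then show False using rest[of x y] new[of x y] unfolding R_def by linarith
    qed
    \<comment> \<open>The geometric sum, written without subtraction on the naturals.\<close>
    have powsum: "(\<Sum>i\<in>{c..<c + k}. 2 ^ i) + 2 ^ c = (2::nat) ^ (c + k)" for k
      by (induction k) auto
    have "sum part S = sum part R + sum part ({(c, b)} \<union> {c..<c + n} \<times> {Suc b})"
      by (subst Sdec, rule sum.union_disjoint) (use finR in \<open>auto simp: R_def\<close>)
    also have "sum part ({(c, b)} \<union> {c..<c + n} \<times> {Suc b})
        = part (c, b) + sum part ({c..<c + n} \<times> {Suc b})"
      by simp
    also have "sum part ({c..<c + n} \<times> {Suc b}) = (\<Sum>i\<in>{c..<c + n}. 2 ^ i) * 3 ^ Suc b"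
      by (rule sum_part_row)
    finally have lhs: "sum part S = sum part R + (2 ^ c * 3 ^ b + (\<Sum>i\<in>{c..<c + n}. 2 ^ i) * 3 ^ Suc b)"
      by (simp add: part_def)
    have "sum part T = sum part R + sum part ({c<..<c + n} \<times> {b} \<union> {(c + n + 1, b)})"
      unfolding T_def R_def[symmetric] Un_assoc
      by (rule sum.union_disjoint) (use finR Rdisj in auto)
    also have "sum part ({c<..<c + n} \<times> {b} \<union> {(c + n + 1, b)})
        = sum part ({c<..<c + n} \<times> {b}) + part (c + n + 1, b)"
      by simp
    also have "sum part ({c<..<c + n} \<times> {b}) = (\<Sum>i\<in>{c<..<c + n}. 2 ^ i) * 3 ^ b"
      by (rule sum_part_row)
    finally have rhs: "sum part T = sum part R
        + ((\<Sum>i\<in>{c<..<c + n}. 2 ^ i) * 3 ^ b + 2 ^ (c + n + 1) * 3 ^ b)"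
      by (simp add: part_def)
    \<comment> \<open>In terms of the tail sum \<open>r\<close> and up to the factor
      \<open>3 ^ b\<close>, the exchanged parts of \<open>S\<close> and of \<open>T\<close> both
      total \<open>3 * r + 4 * 2 ^ c\<close>.\<close>
    define r where "r = (\<Sum>i\<in>{c<..<c + n}. (2::nat) ^ i)"
    have split: "{c..<c + n} = insert c {c<..<c + n}" using n by auto
    have "(\<Sum>i\<in>{c..<c + n}. (2::nat) ^ i) = 2 ^ c + r"
      unfolding split r_def by simp
    with powsum[of n] have "(2::nat) ^ (c + n) = r + 2 ^ c + 2 ^ c"
      and "(\<Sum>i\<in>{c..<c + n}. (2::nat) ^ i) = 2 ^ c + r" by simp_all
    then have "sum part T = sum part S"
      unfolding lhs rhs r_def[symmetric] by (simp add: algebra_simps)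
    then show ?thesis using sum by simp
  qed
  ultimately show "T \<in> staircases U" unfolding staircases_def by blast
  define a where "a = c + n + 1"
  define C where "C = (\<lambda>i. 2 ^ (a - i) * 3 ^ b :: nat) ` {2..n}"
  \<comment> \<open>The index \<open>i\<close> of \<open>transition_B\<close> counts columns
    leftwards from \<open>a\<close>, so the indices from 2 to \<open>n\<close> name exactly the tail
    of the run, which is empty for \<open>n = 1\<close>.\<close>
  have "(\<lambda>i. a - i) ` {2..n} = {c<..<c + n}"
  proof
    show "{c<..<c + n} \<subseteq> (\<lambda>i. a - i) ` {2..n}"
    proof
      fix j assume "j \<in> {c<..<c + n}"
      then have "j = a - (a - j)" "a - j \<in> {2..n}" unfolding a_def by auto
      then show "j \<in> (\<lambda>i. a - i) ` {2..n}" by blast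
    qed
  qed (auto simp: a_def)
  moreover have "C = (\<lambda>j. part (j, b)) ` ((\<lambda>i. a - i) ` {2..n})"
    unfolding C_def image_image by (simp add: part_def)
  ultimately have C: "C = part ` ({c<..<c + n} \<times> {b})" by force
  have C3: "(\<lambda>x. 3 * x) ` C = part ` ({c<..<c + n} \<times> {Suc b})"
    unfolding C image_image by (force simp: part_def image_iff)
  have "top_exponent (part ` T) b a"
    unfolding top_exponent_def part_mem_image T_def a_def using below by fastforce
  \<comment> \<open>Column \<open>a - 1 = c + n\<close> of row \<open>b\<close> stays free: old
    parts there end at column \<open>c\<close>, and the lowered tail ends at
    \<open>c + n - 1\<close>.\<close>
  moreover have "\<not> (a \<ge> 1 \<and> 2 ^ (a - 1) * 3 ^ b \<in> part ` T)"
    unfolding part_mem_image T_def a_def using below[of "c + n" b] n by auto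
  moreover have "C \<subseteq> part ` T" unfolding C T_def by blast
  moreover have "2 ^ c * 3 ^ b \<notin> part ` T" unfolding part_mem_image T_def by auto
  moreover have "\<forall>d<b. 2 ^ (c + 1) * 3 ^ d \<notin> part ` T"
  proof (intro allI impI)
    fix d assume "d < b"
    then show "2 ^ (c + 1) * 3 ^ d \<notin> part ` T"
      unfolding part_mem_image T_def using below[of "c + 1" d] by auto
  qed
  moreover have "part ` S = (part ` T - C - {2 ^ a * 3 ^ b}) \<union> (\<lambda>x. 3 * x) ` C
      \<union> {2 ^ c * 3 ^ b, 2 ^ c * 3 ^ (b + 1)}"
  proof -
    have "S = (T - {c<..<c + n} \<times> {b} - {(a, b)}) \<union> {c<..<c + n} \<times> {Suc b}
        \<union> {(c, b), (c, Suc b)}" (is "S = ?R")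
    proof
      show "S \<subseteq> ?R"
      proof
        fix p assume p: "p \<in> S"
        obtain x y where xy: "p = (x, y)" by force
        show "p \<in> ?R"
          using p below[of x y] n unfolding xy T_def a_def by (cases "x = c") auto
      qed
      show "?R \<subseteq> S" using mem memb run unfolding T_def a_def by auto
    qed
    then have "part ` S = part ` ?R" by (rule arg_cong)
    also have "\<dots> = (part ` T - C - {part (a, b)}) \<union> (\<lambda>x. 3 * x) ` C \<union> {part (c, b), part (c, Suc b)}"
      unfolding C3 unfolding C by (simp only: image_Un image_set_diff[OF inj_part] image_insert image_empty)
    finally show ?thesis by (simp add: part_def)
  qed
  ultimately show "transition_B b (part ` T) (part ` S)"
    unfolding transition_B_def using n a_def C_def by (intro exI conjI) assumption+
qed

section \<open>Descent to the binary expansion\<close>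

text \<open>The last condition says that \<open>x - [(x, b) \<in> S]\<close>, for \<open>(x, b + 1)\<close> the leftmost part of the
  top row, grows by at least 2 with each move; this is what makes a row of width \<open>w\<close> cost only
  about \<open>w / 2\<close> moves.\<close>

lemma descent_step:
  assumes S: "S \<in> staircases U" and mem: "(m, Suc b) \<in> S"
    and rows_le: "\<forall>(x, y)\<in>S. y \<le> Suc b"
    and row_ge: "\<forall>x. (x, Suc b) \<in> S \<longrightarrow> m \<le> x"
  obtains T where "T \<in> staircases U" "(part ` S, part ` T) \<in> parcs (partition_graph U)"
    "\<forall>(x, y)\<in>T. y \<le> Suc b"
    "\<forall>x. (x, Suc b) \<in> T \<longrightarrow> (x, Suc b) \<in> S"
    "\<forall>x. (x, Suc b) \<in> T \<longrightarrow> m + 2 + of_bool ((m, b) \<in> S) \<le> x + of_bool ((x, b) \<in> T)"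
proof (cases "(m, b) \<in> S")
  case False
  define T where "T = insert (m, b) (insert (Suc m, b) (S - {(m, Suc b)}))"
  have T: "T \<in> staircases U" "transition_A b (part ` T) (part ` S)"
    unfolding T_def using undo_transition_A[OF S mem rows_le row_ge False] by blast+
  have arc: "(part ` S, part ` T) \<in> parcs (partition_graph U)"
    using S T unfolding partition_graph_def chained_partitions_eq transition_def by auto
  have "m + 2 + of_bool ((m, b) \<in> S) \<le> x + of_bool ((x, b) \<in> T)" if "(x, Suc b) \<in> T" for x
  \<comment> \<open>The next part of the top row may lie only one column further; it then lies above
    the new part \<open>(Suc m, b)\<close>, and the indicator makes up for the missing
    column.\<close>
  proof -
    have "m < x" using that row_ge[rule_format, of x] unfolding T_def by (auto simp: le_less)
    then show ?thesis using False unfolding T_def by (cases "x = Suc m") auto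
  qed
  moreover have "\<forall>(x, y)\<in>T. y \<le> Suc b"
  proof clarify
    fix x y assume "(x, y) \<in> T"
    then have "(x, y) \<in> S \<or> y = b" unfolding T_def by blast
    then show "y \<le> Suc b" using rows_le by auto
  qed
  moreover have "\<forall>x. (x, Suc b) \<in> T \<longrightarrow> (x, Suc b) \<in> S" unfolding T_def by simp
  ultimately show ?thesis using that T(1) arc by blast
next
  case True
  have fin: "finite S" using S unfolding staircases_def staircase_def by blast
  \<comment> \<open>The length of the run of consecutive parts starting at
    \<open>(m, Suc b)\<close>; it exists because \<open>S\<close> is finite.\<close>
  define n where "n = (LEAST n. (m + n, Suc b) \<notin> S)"
  have "\<exists>n. (m + n, Suc b) \<notin> S"
  proof (rule ccontr)
    assume "\<not> ?thesis"
    then have "(\<lambda>n. (m + n, Suc b)) ` UNIV \<subseteq> S" by blast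
    moreover have "inj (\<lambda>n. (m + n, Suc b))" by (auto intro: injI)
    ultimately show False using fin finite_subset finite_imageD infinite_UNIV_nat by metis
  qed
  then have stop: "(m + n, Suc b) \<notin> S" unfolding n_def by (rule LeastI_ex)
  have run: "\<forall>i\<in>{m..<m + n}. (i, Suc b) \<in> S"
  proof
    fix i assume "i \<in> {m..<m + n}"
    then show "(i, Suc b) \<in> S"
      using not_less_Least[of "i - m" "\<lambda>n. (m + n, Suc b) \<notin> S"] unfolding n_def by auto
  qed
  have n: "n \<ge> 1" using stop mem by (cases n) auto
  define T where "T = (S - {(m, b)} - {m..<m + n} \<times> {Suc b}) \<union> {m<..<m + n} \<times> {b} \<union> {(m + n + 1, b)}"
  have T: "T \<in> staircases U" "transition_B b (part ` T) (part ` S)"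
    unfolding T_def using undo_transition_B[OF S mem rows_le row_ge True n run stop] by blast+
  have arc: "(part ` S, part ` T) \<in> parcs (partition_graph U)"
    using S T unfolding partition_graph_def chained_partitions_eq transition_def by auto
  have "m + 2 + of_bool ((m, b) \<in> S) \<le> x + of_bool ((x, b) \<in> T)" if x: "(x, Suc b) \<in> T" for x
  \<comment> \<open>The whole run is gone and the column after it was empty, so \<open>x\<close> is
    at least \<open>m + n + 1\<close>; in case of equality the new part
    \<open>(m + n + 1, b)\<close> supplies the indicator.\<close>
  proof -
    have "(x, Suc b) \<in> S" "x \<notin> {m..<m + n}" using x unfolding T_def by auto
    then have "m + n < x" using row_ge[rule_format, of x] stop by (cases "x = m + n") auto
    then show ?thesis using n unfolding T_def by (cases "x = m + n + 1") auto
  qed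
  moreover have "\<forall>(x, y)\<in>T. y \<le> Suc b"
  proof clarify
    fix x y assume "(x, y) \<in> T"
    then have "(x, y) \<in> S \<or> y = b" unfolding T_def by blast
    then show "y \<le> Suc b" using rows_le by auto
  qed
  moreover have "\<forall>x. (x, Suc b) \<in> T \<longrightarrow> (x, Suc b) \<in> S" unfolding T_def by simp
  ultimately show ?thesis using that T(1) arc by blast
qed

text \<open>The potential \<open>m + of_bool ((m, b) \<in> S)\<close> rises by at least 2 from one
  move to the next and is at most \<open>M + 1\<close> before the last move; that last move accounts
  for the other 2 in \<open>M + 3\<close>.\<close>

lemma clear_row:
  assumes "S \<in> staircases U" "(m, Suc b) \<in> S"
    and "\<forall>(x, y)\<in>S. y \<le> Suc b"
    and "\<forall>x. (x, Suc b) \<in> S \<longrightarrow> m \<le> x \<and> x \<le> M"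
  shows "\<exists>k T. T \<in> staircases U \<and> (part ` S, part ` T) \<in> parcs (partition_graph U) ^^ k \<and>
    (\<forall>(x, y)\<in>T. y \<le> b) \<and> 2 * k + m + of_bool ((m, b) \<in> S) \<le> M + 3"
  using assms
proof (induction "M - m" arbitrary: m S rule: less_induct)
  case less
  have min: "\<forall>x. (x, Suc b) \<in> S \<longrightarrow> m \<le> x" using less.prems(4) by blast
  have mM: "m \<le> M" using less.prems by blast
  obtain T where T: "T \<in> staircases U" "(part ` S, part ` T) \<in> parcs (partition_graph U)"
    "\<forall>(x, y)\<in>T. y \<le> Suc b"
    "\<forall>x. (x, Suc b) \<in> T \<longrightarrow> (x, Suc b) \<in> S"
    "\<forall>x. (x, Suc b) \<in> T \<longrightarrow> m + 2 + of_bool ((m, b) \<in> S) \<le> x + of_bool ((x, b) \<in> T)"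
    using descent_step[OF less.prems(1,2) less.prems(3) min] by blast
  show ?case
  proof (cases "\<exists>x. (x, Suc b) \<in> T")
    case False
    then have "\<forall>(x, y)\<in>T. y \<le> b" using T(3) by (fastforce simp: le_Suc_eq)
    moreover have "(part ` S, part ` T) \<in> parcs (partition_graph U) ^^ 1" using T(2) by simp
    moreover have "2 * 1 + m + of_bool ((m, b) \<in> S) \<le> M + 3" using mM by simp
    ultimately show ?thesis using T(1) by blast
  next
    case True
    define x where "x = (LEAST x. (x, Suc b) \<in> T)"
    have x: "(x, Suc b) \<in> T" using True unfolding x_def by (rule LeastI_ex)
    have x': "m + 2 + of_bool ((m, b) \<in> S) \<le> x + of_bool ((x, b) \<in> T)" using T(5) x by blast
    have xM: "x \<le> M" using T(4) x less.prems(4) by blast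
    have "x > m" using x' by (auto split: if_splits simp: of_bool_def)
    then have "M - x < M - m" using xM by simp
    moreover have "\<forall>z. (z, Suc b) \<in> T \<longrightarrow> x \<le> z \<and> z \<le> M"
      using T(4) less.prems(4) unfolding x_def by (auto intro: Least_le)
    ultimately obtain k Q where Q: "Q \<in> staircases U"
      "(part ` T, part ` Q) \<in> parcs (partition_graph U) ^^ k" "\<forall>(x, y)\<in>Q. y \<le> b"
      "2 * k + x + of_bool ((x, b) \<in> T) \<le> M + 3"
      using less.hyps[OF _ T(1) x T(3)] by blast
    have "(part ` S, part ` Q) \<in> parcs (partition_graph U) ^^ Suc k"
      using T(2) Q(2) by (rule relpow_Suc_I2)
    moreover have "2 * Suc k + m + of_bool ((m, b) \<in> S) \<le> M + 3"
      using Q(4) x' by simp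
    ultimately show ?thesis using Q(1,3) by blast
  qed
qed

text \<open>Rows are cleared from the top down. Clearing a row may fill the one below, but every
  partition on the way still sums to \<open>U\<close>, so the width limits behind \<open>f\<close>
  hold throughout.\<close>

lemma clear_rows:
  assumes f: "\<forall>b\<ge>1. \<forall>x. 2 ^ x * 3 ^ b \<le> U \<longrightarrow> x + 2 \<le> 2 * f b"
    and "S \<in> staircases U" "\<forall>(x, y)\<in>S. y \<le> N"
  shows "\<exists>k T. T \<in> staircases U \<and> (part ` S, part ` T) \<in> parcs (partition_graph U) ^^ k \<and>
    (\<forall>(x, y)\<in>T. y = 0) \<and> k \<le> (\<Sum>b=1..N. f b)"
  using assms(2,3)
proof (induction N arbitrary: S)
  case 0
  then have "(part ` S, part ` S) \<in> parcs (partition_graph U) ^^ 0 \<and> (\<forall>(x, y)\<in>S. y = 0)" by auto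
  then show ?case using 0 by fastforce
next
  case (Suc b)
  define R where "R = {x. (x, Suc b) \<in> S}"
  have "finite S" using Suc.prems unfolding staircases_def staircase_def by blast
  then have finR: "finite R"
    unfolding R_def by (rule finite_subset[OF _ finite_imageI[of S fst], rotated]) force
  obtain k T where T: "T \<in> staircases U" "(part ` S, part ` T) \<in> parcs (partition_graph U) ^^ k"
    "\<forall>(x, y)\<in>T. y \<le> b" "k \<le> f (Suc b)"
  proof (cases "R = {}")
    case True
    then have "\<forall>(x, y)\<in>S. y \<le> b" using Suc.prems(2) unfolding R_def by (fastforce simp: le_Suc_eq)
    then show ?thesis using Suc.prems(1) by (intro that[of S 0]) auto
  next
    case False
    have mem: "(Min R, Suc b) \<in> S" "(Max R, Suc b) \<in> S"
      using Min_in[OF finR False] Max_in[OF finR False] unfolding R_def by blast+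
    have "\<forall>x. (x, Suc b) \<in> S \<longrightarrow> Min R \<le> x \<and> x \<le> Max R"
      using finR unfolding R_def by simp
    from clear_row[OF Suc.prems(1) mem(1) Suc.prems(2) this]
    obtain k T where T: "T \<in> staircases U" "(part ` S, part ` T) \<in> parcs (partition_graph U) ^^ k"
      "\<forall>(x, y)\<in>T. y \<le> b" "2 * k + Min R + of_bool ((Min R, b) \<in> S) \<le> Max R + 3" by blast
    have "Max R + 2 \<le> 2 * f (Suc b)"
      using f[rule_format, of "Suc b" "Max R"] part_le[OF Suc.prems(1) mem(2)] by simp
    \<comment> \<open>Parity: \<open>2 * k\<close> is at most \<open>Max R + 3\<close>, hence at
      most \<open>2 * f (Suc b) + 1\<close>, and the odd excess is lost.\<close>
    then have "k \<le> f (Suc b)" using T(4) by linarith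
    then show ?thesis using T that by blast
  qed
  from Suc.IH[OF T(1) T(3)] obtain l Q where Q: "Q \<in> staircases U"
    "(part ` T, part ` Q) \<in> parcs (partition_graph U) ^^ l"
    "\<forall>(x, y)\<in>Q. y = 0" "l \<le> (\<Sum>b=1..b. f b)" by blast
  have "(part ` S, part ` Q) \<in> parcs (partition_graph U) ^^ (k + l)"
    using T(2) Q(2) by (auto simp: relpow_add)
  moreover have "k + l \<le> (\<Sum>b=1..Suc b. f b)" using T(4) Q(4) by simp
  ultimately show ?case using Q(1,3) by blast
qed

text \<open>Uniqueness of the binary expansion, in the form that \<open>set_decode\<close> inverts
  \<open>set_encode\<close> on finite sets. It makes all descents end at the same vertex.\<close>

lemma staircase_row_0_eq:
  assumes "S \<in> staircases U" "\<forall>(x, y)\<in>S. y = 0"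
  shows "S = set_decode U \<times> {0}"
proof -
  have S: "S = fst ` S \<times> {0}" using assms(2) by force
  have fin: "finite (fst ` S)"
    using assms(1) unfolding staircases_def staircase_def by blast
  have "U = sum part (fst ` S \<times> {0})"
    using assms(1) S unfolding staircases_def by simp
  also have "\<dots> = set_encode (fst ` S)"
    unfolding sum_part_row set_encode_def by simp
  finally show ?thesis using S fin by (metis set_encode_inverse)
qed

definition binary_partition :: "nat \<Rightarrow> nat set" where
  "binary_partition U = (\<lambda>a. 2 ^ a) ` set_decode U"

lemma binary_partition_mem: "binary_partition U \<in> chained_partitions U"
proof -
  have "staircase (set_decode U \<times> {0})" unfolding staircase_def by auto
  moreover have "sum part (set_decode U \<times> {0}) = U"
    using set_decode_inverse[of U] by (simp add: sum_part_row set_encode_def)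
  moreover have "binary_partition U = part ` (set_decode U \<times> {0})"
    unfolding binary_partition_def by (force simp: part_def image_iff)
  ultimately show ?thesis unfolding chained_partitions_eq staircases_def by blast
qed

text \<open>A part in row \<open>y\<close> is at least \<open>3 ^ y\<close>, so the bound on
  \<open>U\<close> leaves only the rows up to \<open>N\<close>.\<close>

lemma walk_to_binary_partition:
  assumes f: "\<forall>b\<ge>1. \<forall>x. 2 ^ x * 3 ^ b \<le> U \<longrightarrow> x + 2 \<le> 2 * f b"
    and N: "U < 3 ^ Suc N" and P: "P \<in> chained_partitions U"
  shows "\<exists>k \<le> \<Sum>b=1..N. f b. (P, binary_partition U) \<in> parcs (partition_graph U) ^^ k"
proof -
  obtain S where S: "S \<in> staircases U" "P = part ` S" using P unfolding chained_partitions_eq by blast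
  have "y \<le> N" if "(x, y) \<in> S" for x y
  proof -
    have "(3::nat) ^ y \<le> 2 ^ x * 3 ^ y" by simp
    also have "\<dots> \<le> U" using part_le[OF S(1) that] .
    also note N
    finally have "y < Suc N" by (rule power_less_imp_less_exp[rotated]) simp
    then show ?thesis by simp
  qed
  then have "\<forall>(x, y)\<in>S. y \<le> N" by blast
  from clear_rows[OF f S(1) this] obtain k T where T: "T \<in> staircases U"
    "(part ` S, part ` T) \<in> parcs (partition_graph U) ^^ k"
    "\<forall>(x, y)\<in>T. y = 0" "k \<le> (\<Sum>b=1..N. f b)" by blast
  have "part ` T = binary_partition U"
    unfolding staircase_row_0_eq[OF T(1,3)] binary_partition_def by (force simp: part_def image_iff)
  then show ?thesis using T S(2) by auto
qed

section \<open>Counting the moves\<close>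

text \<open>Logarithms of \<open>3 \<le> 4\<close> and of \<open>8 \<le> 9\<close>.\<close>

lemma ln_2_ln_3_bounds: "ln 3 \<le> 2 * ln (2::real)" "3 * ln 2 \<le> 2 * ln (3::real)"
proof -
  have "ln 3 \<le> ln ((2::real) ^ 2)" by (subst ln_le_cancel_iff) auto
  then show "ln 3 \<le> 2 * ln (2::real)" by (subst (asm) ln_realpow) auto
  have "ln ((2::real) ^ 3) \<le> ln (3 ^ 2)" by (subst ln_le_cancel_iff) auto
  then show "3 * ln 2 \<le> 2 * ln (3::real)" by (subst (asm) (1 2) ln_realpow) auto
qed

lemma ln_part_le:
  assumes "2 ^ x * 3 ^ b \<le> U"
  shows "real x * ln 2 + real b * ln 3 \<le> ln (real U)"
proof -
  have "real (2 ^ x * 3 ^ b) \<le> real U" using assms by (rule of_nat_mono)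
  moreover have "0 < 2 ^ x * (3::real) ^ b" by simp
  ultimately have "ln (2 ^ x * 3 ^ b) \<le> ln (real U)" by (intro ln_mono) simp_all
  then show ?thesis by (simp add: ln_mult ln_realpow)
qed

text \<open>Summing half the row widths gives an area of main order \<open>X\<^sup>2\<close>. The
  constant excess per row is absorbed by the triangular shape as soon as three rows above row 0 can
  occur, which is what \<open>27 = 3 ^ 3\<close> provides.\<close>

lemma move_count_large:
  assumes U: "U \<ge> 27"
  obtains N f where "\<forall>b\<ge>1. \<forall>x. 2 ^ x * 3 ^ b \<le> U \<longrightarrow> x + 2 \<le> 2 * f b" "U < 3 ^ Suc N"
    "2 * ln 2 * ln 3 * real (\<Sum>b=1..N. f b) \<le> (ln (real U))\<^sup>2"
proof -
  define X l t where "X = ln (real U)" and "l = ln (2::real)" and "t = ln (3::real)"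
  have lt: "l > 0" "t > 0" "3 * l \<le> 2 * t"
    using ln_2_ln_3_bounds unfolding l_def t_def by auto
  obtain N where N: "3 ^ N \<le> U" "U < 3 ^ (N + 1)"
    using ex_power_ivl1[of 3 U] U by auto
  have N3: "N \<ge> 3"
  proof (rule ccontr)
    assume "\<not> N \<ge> 3"
    then have "(3::nat) ^ (N + 1) \<le> 3 ^ 3" by (intro power_increasing) auto
    then show False using U N by simp
  qed
  have NX: "real N * t \<le> X" using ln_part_le[of 0 N U] N unfolding X_def t_def by simp
  \<comment> \<open>Columns in row \<open>b\<close> are at most \<open>(X - real b * t) / l\<close>;
    \<open>g b\<close> is half of this bound plus 3, as in \<open>clear_row\<close>.\<close>
  define g where "g b = (X - real b * t + 3 * l) / (2 * l)" for b
  define f where "f b = nat \<lfloor>g b\<rfloor>" for b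
  have "x + 2 \<le> 2 * f b" if "2 ^ x * 3 ^ b \<le> U" for x b
  proof -
    have "real x * l + real b * t \<le> X" using ln_part_le[OF that] unfolding X_def l_def t_def .
    then have "(real x + 3) / 2 \<le> g b" unfolding g_def using lt by (simp add: field_simps)
    moreover have "real ((x + 3) div 2) \<le> (real x + 3) / 2"
      using of_nat_div_le_of_nat[of "x + 3" 2, where 'a = real] by simp
    ultimately have "real ((x + 3) div 2) \<le> g b" by linarith
    then have "(x + 3) div 2 \<le> f b" unfolding f_def by (simp add: le_nat_floor)
    then show ?thesis by linarith
  qed
  moreover have "2 * l * t * real (\<Sum>b=1..N. f b) \<le> X\<^sup>2"
  proof -
    have "real (f b) \<le> g b" if "b \<in> {1..N}" for b
    proof -
      have "real b * t \<le> real N * t" using that lt by simp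
      then have "0 \<le> X - real b * t + 3 * l" using lt NX by linarith
      then have "0 \<le> g b" unfolding g_def using lt by simp
      then show ?thesis unfolding f_def by simp
    qed
    then have "real (\<Sum>b=1..N. f b) \<le> (\<Sum>b=1..N. g b)" unfolding of_nat_sum by (rule sum_mono)
    then have "2 * l * t * real (\<Sum>b=1..N. f b) \<le> 2 * l * t * (\<Sum>b=1..N. g b)"
      using lt by (intro mult_left_mono) auto
    also have "\<dots> = (\<Sum>b=1..N. t * (X - real b * t + 3 * l))"
      unfolding sum_distrib_left g_def using lt by (intro sum.cong) auto
    \<comment> \<open>The arithmetic series, split into a main term and a correction whose sign is
      determined next.\<close>
    also have "\<dots> = real N * t * X + t * real N * (3 * l - t * (real N + 1) / 2)"
    proof -
      have "(\<Sum>b=1..n. t * (X - real b * t + 3 * l))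
          = real n * t * X + t * real n * (3 * l - t * (real n + 1) / 2)" for n
      proof (induction n)
        case (Suc n)
        have "t * (X - (real n + 1) * t + 3 * l) + (real n * t * X + t * real n * (3 * l - t * (real n + 1) / 2))
          = (real n + 1) * t * X + t * (real n + 1) * (3 * l - t * (real n + 2) / 2)"
          by algebra
        then show ?case using Suc by (simp add: add_ac)
      qed simp
      then show ?thesis .
    qed
    \<comment> \<open>With \<open>N\<close> at least 3, \<open>t * (real N + 1)\<close> is at least
      \<open>4 * t\<close>, which is at least \<open>6 * l\<close> since 8 is at most 9.\<close>
    also have "\<dots> \<le> real N * t * X"
    proof -
      have "t * 4 \<le> t * (real N + 1)" using N3 lt by (intro mult_left_mono) auto
      then have "6 * l \<le> t * (real N + 1)" using lt(3) by linarith
      then have "3 * l - t * (real N + 1) / 2 \<le> 0" by linarith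
      then have "t * real N * (3 * l - t * (real N + 1) / 2) \<le> 0"
        using lt by (intro mult_nonneg_nonpos) auto
      then show ?thesis by simp
    qed
    also have "\<dots> \<le> X * X"
    proof -
      have "0 \<le> X" using U unfolding X_def by simp
      then show ?thesis using NX by (intro mult_right_mono)
    qed
    finally show ?thesis by (simp add: power2_eq_square)
  qed
  ultimately show ?thesis using that[of f N] N unfolding X_def l_def t_def by simp
qed

lemma two_power_less_imp:
  fixes U :: nat
  assumes "2 ^ x * 3 ^ b \<le> U" "U < 2 ^ m * 3 ^ b"
  shows "x < m"
proof -
  have "(2::nat) ^ x * 3 ^ b < 2 ^ m * 3 ^ b" using assms by linarith
  then have "(2::nat) ^ x < 2 ^ m" by simp
  then show ?thesis by (rule power_less_imp_less_exp[rotated]) simp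
qed

text \<open>Below 27 only rows 1 and 2 matter, and the cases split where their move counts or the
  number of rows change. In each range \<open>ln (real U)\<close> is bounded below through the least
  element. For 3 the method would need \<open>2 * ln 2 \<le> ln 3\<close>, which is false.\<close>

lemma move_count_small:
  assumes U: "U < 27" "1 \<le> U" "U \<noteq> 3"
  obtains N f where "\<forall>b\<ge>1. \<forall>x. 2 ^ x * 3 ^ b \<le> U \<longrightarrow> x + 2 \<le> 2 * f b" "U < 3 ^ Suc N"
    "2 * ln 2 * ln 3 * real (\<Sum>b=1..N. f b) \<le> (ln (real U))\<^sup>2"
proof -
  define l t where "l = ln (2::real)" and "t = ln (3::real)"
  have lt: "l > 0" "t > 0" "3 * l \<le> 2 * t" "t \<le> 2 * l"
    using ln_2_ln_3_bounds unfolding l_def t_def by auto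
  have sq: "(real x * l + real b * t)\<^sup>2 \<le> (ln (real U))\<^sup>2" if "2 ^ x * 3 ^ b \<le> U" for x b
    using ln_part_le[OF that] lt unfolding l_def t_def by (intro power_mono) auto
  note result = that
  text \<open>With at most \<open>p\<close> columns in row 1 and \<open>q\<close> columns in row 2, these rows need at most
    \<open>(p + 2) div 2\<close> and \<open>(q + 2) div 2\<close> moves.\<close>
  have main: thesis
    if pq: "U < 2 ^ p * 3" "U < 2 ^ q * 9"
      and m: "(p + 2) div 2 \<le> m 1" "(q + 2) div 2 \<le> m 2" and N: "U < 3 ^ Suc N"
      and bd: "2 * l * t * real (\<Sum>b=1..N. m b) \<le> (ln (real U))\<^sup>2" for p q N m
  proof (rule result[of m N], intro allI impI)
    fix x b :: nat assume b: "b \<ge> 1" and x: "2 ^ x * 3 ^ b \<le> U"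
    have "(3::nat) ^ b \<le> 2 ^ x * 3 ^ b" by simp
    also have "\<dots> < 3 ^ 3" using x U by simp
    finally have "b < 3" by (rule power_less_imp_less_exp[rotated]) simp
    with b consider "b = 1" | "b = 2" by linarith
    then show "x + 2 \<le> 2 * m b"
    proof cases
      case 1
      have "x < p" using two_power_less_imp[of x 1 U p] x pq 1 by simp
      then show ?thesis unfolding 1 using m by linarith
    next
      case 2
      have "x < q" using two_power_less_imp[of x 2 U q] x pq 2 by simp
      then show ?thesis unfolding 2 using m by linarith
    qed
  qed (use N bd in \<open>simp_all add: l_def t_def\<close>)
  \<comment> \<open>Allows \<open>i\<close> moves for row 1 and \<open>j\<close> for row 2. The sum
    up to \<open>N\<close> drops the entries of rows that cannot occur, so their positive values
    cost nothing.\<close>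
  define m where "m i j b = (if b = 1 then i else j)" for i j b :: nat
  have m: "m i j (Suc 0) = i" "m i j 2 = j" "(\<Sum>b=Suc 0..2. m i j b) = i + j" for i j
    by (simp_all add: m_def numeral_2_eq_2)
  consider "U < 3" | "4 \<le> U" "U < 6" | "6 \<le> U" "U < 9" | "9 \<le> U" "U < 18"
    | "18 \<le> U" "U < 24" | "24 \<le> U" using U by linarith
  then show thesis
  proof cases
    case 1
    then show ?thesis by (intro main[of 0 0 "m 1 1" 0]) (auto simp: m)
  next
    case 2
    have "2 * (l * t) \<le> (2 * l)\<^sup>2"
      using mult_left_mono[OF lt(4), of "2 * l"] lt by (simp add: power2_eq_square algebra_simps)
    also have "\<dots> \<le> (ln (real U))\<^sup>2" using sq[of 2 0] 2 by simp
    finally show ?thesis using 2 by (intro main[of 1 0 "m 1 1" 1]) (auto simp: m)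
  next
    case 3
    have "4 * (l * t) \<le> (l + t)\<^sup>2" using sum_squares_bound[of l t] by (simp add: power2_sum)
    also have "\<dots> \<le> (ln (real U))\<^sup>2" using sq[of 1 1] 3 by simp
    finally show ?thesis using 3 by (intro main[of 2 0 "m 2 1" 1]) (auto simp: m)
  next
    case 4
    have "6 * (l * t) \<le> (2 * t)\<^sup>2"
      using mult_left_mono[OF lt(3), of "2 * t"] lt by (simp add: power2_eq_square algebra_simps)
    also have "\<dots> \<le> (ln (real U))\<^sup>2" using sq[of 0 2] 4 by simp
    finally show ?thesis using 4
      by (intro main[of 3 1 "m 2 1" 2]) (auto simp: m)
  next
    case 5
    have "8 * (l * t) \<le> (l + 2 * t)\<^sup>2"
      using sum_squares_bound[of l "2 * t"] by (simp add: power2_sum)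
    also have "\<dots> \<le> (ln (real U))\<^sup>2" using sq[of 1 2] 5 by simp
    finally show ?thesis using 5
      by (intro main[of 3 2 "m 2 2" 2]) (auto simp: m)
  next
    case 6
    have "(3 * l + t)\<^sup>2 - 10 * (l * t) = (2 * l - t)\<^sup>2 + 5 * l\<^sup>2"
      by (simp add: power2_eq_square algebra_simps)
    then have "10 * (l * t) \<le> (3 * l + t)\<^sup>2"
      using zero_le_power2[of "2 * l - t"] zero_le_power2[of l] by linarith
    also have "\<dots> \<le> (ln (real U))\<^sup>2" using sq[of 3 1] 6 by simp
    finally show ?thesis using U(1)
      by (intro main[of 4 2 "m 3 2" 2]) (auto simp: m)
  qed
qed

lemma move_count:
  assumes "1 \<le> U" "U \<noteq> 3"
  obtains N f where "\<forall>b\<ge>1. \<forall>x. 2 ^ x * 3 ^ b \<le> U \<longrightarrow> x + 2 \<le> 2 * f b" "U < 3 ^ Suc N"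
    "2 * ln 2 * ln 3 * real (\<Sum>b=1..N. f b) \<le> (ln (real U))\<^sup>2"
proof (cases "U < 27")
  case True
  then show ?thesis by (rule move_count_small[OF _ assms that])
next
  case False
  then have "27 \<le> U" by simp
  then show ?thesis by (rule move_count_large[OF _ that])
qed

section \<open>Distances in the partition graph\<close>

lemma relpow_partition_graph_sym:
  assumes "(P, Q) \<in> parcs (partition_graph U) ^^ k"
  shows "(Q, P) \<in> parcs (partition_graph U) ^^ k"
  using assms
proof (induction k arbitrary: Q)
  case (Suc k)
  then obtain R where "(P, R) \<in> parcs (partition_graph U) ^^ k" "(R, Q) \<in> parcs (partition_graph U)"
    by auto
  then have "(R, P) \<in> parcs (partition_graph U) ^^ k" "(Q, R) \<in> parcs (partition_graph U)"
    using Suc.IH by (auto simp: partition_graph_def)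
  then show ?case by (metis relpow_Suc_I2)
qed simp

text \<open>Relation powers are convenient for counting moves; this turns them into the arc walks on
  which reachability and \<open>wf_digraph.\<mu>\<close> are based.\<close>

lemma awalk_of_relpow:
  assumes "(P, Q) \<in> parcs (partition_graph U) ^^ k" "P \<in> chained_partitions U"
  shows "\<exists>p. pre_digraph.awalk (with_proj (partition_graph U)) P p Q \<and> length p = k"
  using assms
proof (induction k arbitrary: P)
  case 0
  then show ?case by (simp add: pre_digraph.awalk_def pre_digraph.cas.simps partition_graph_def)
next
  case (Suc k)
  obtain R where R: "(P, R) \<in> parcs (partition_graph U)" "(R, Q) \<in> parcs (partition_graph U) ^^ k"
    using Suc.prems(1) by (rule relpow_Suc_E2)
  then have "R \<in> chained_partitions U" by (simp add: partition_graph_def)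
  from Suc.IH[OF R(2) this] obtain p where
    "pre_digraph.awalk (with_proj (partition_graph U)) R p Q" "length p = k" by blast
  then have "pre_digraph.awalk (with_proj (partition_graph U)) P ((P, R) # p) Q"
    using R(1) Suc.prems(2)
    by (simp add: pre_digraph.awalk_def pre_digraph.cas.simps partition_graph_def)
  with \<open>length p = k\<close> show ?case by (metis length_Cons)
qed

lemma connected_and_diameter_le:
  assumes walks: "\<And>P Q. P \<in> chained_partitions U \<Longrightarrow> Q \<in> chained_partitions U \<Longrightarrow>
      \<exists>k. (P, Q) \<in> parcs (partition_graph U) ^^ k \<and> real k \<le> D"
  shows "Digraph_Component.connected (with_proj (partition_graph U))"
    and "graph_diameter (with_proj (partition_graph U)) \<le> ereal D"
proof -
  interpret G: wf_digraph "with_proj (partition_graph U)" by (rule wf_digraph_partition_graph)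
  have verts: "verts (with_proj (partition_graph U)) = chained_partitions U"
    by (simp add: partition_graph_def)
  have aw: "\<exists>p. G.awalk P p Q \<and> real (length p) \<le> D"
    if PQ: "P \<in> chained_partitions U" "Q \<in> chained_partitions U" for P Q
  proof -
    obtain k where "(P, Q) \<in> parcs (partition_graph U) ^^ k" "real k \<le> D"
      using walks[OF PQ] by blast
    with awalk_of_relpow[OF this(1) PQ(1)] show ?thesis by blast
  qed
  show "Digraph_Component.connected (with_proj (partition_graph U))"
    unfolding Digraph_Component.connected_def strongly_connected_def
  proof (intro conjI ballI)
    \<comment> \<open>The connectedness notion includes having a vertex, and the binary expansion is
      one for every \<open>U\<close>.\<close>
    show "verts (with_proj (mk_symmetric (with_proj (partition_graph U)))) \<noteq> {}"
      using binary_partition_mem[of U] verts by auto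
  next
    fix P Q assume "P \<in> verts (with_proj (mk_symmetric (with_proj (partition_graph U))))"
      "Q \<in> verts (with_proj (mk_symmetric (with_proj (partition_graph U))))"
    then have "P \<in> chained_partitions U" "Q \<in> chained_partitions U" using verts by auto
    from aw[OF this] have "P \<rightarrow>\<^sup>*\<^bsub>with_proj (partition_graph U)\<^esub> Q"
      by (auto intro: G.reachable_awalkI)
    then show "P \<rightarrow>\<^sup>*\<^bsub>with_proj (mk_symmetric (with_proj (partition_graph U)))\<^esub> Q"
      by (rule G.reachable_mk_symmetricI)
  qed
  show "graph_diameter (with_proj (partition_graph U)) \<le> ereal D"
    unfolding graph_diameter_def verts
  proof (intro SUP_least)
    fix P Q assume "P \<in> chained_partitions U" "Q \<in> chained_partitions U"
    from aw[OF this] obtain p where p: "G.awalk P p Q" "real (length p) \<le> D" by blast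
    \<comment> \<open>The distance is an infimum of walk costs, and with unit weights the cost of
      the walk found is its length.\<close>
    have "G.\<mu> (\<lambda>_. 1) P Q \<le> ereal (G.awalk_cost (\<lambda>_. 1) p)"
      using p(1) by (rule G.min_cost_le_walk_cost)
    also have "G.awalk_cost (\<lambda>_. 1) p = real (length p)"
      by (simp add: G.awalk_cost_def sum_list_triv)
    finally show "G.\<mu> (\<lambda>_. 1) P Q \<le> ereal D" using p(2) by (meson ereal_less_eq(3) order_trans)
  qed
qed

section \<open>The exceptional case \<open>U = 3\<close>, followed by the bound for all
  \<open>U\<close>\<close>

lemma chained_partitions_3: "chained_partitions 3 \<subseteq> {{3}, {1, 2}}"
proof
  fix P assume P: "P \<in> chained_partitions 3"
  have fin: "finite P" and sum: "\<Sum>P = 3" using P unfolding chained_partitions_def by auto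
  have "P \<subseteq> {1, 2, 3}"
  proof
    fix x assume x: "x \<in> P"
    have "x \<le> 3" using member_le_sum[of x P "\<lambda>x. x"] x fin sum by simp
    moreover have "x > 0" using P x unfolding chained_partitions_def by auto
    ultimately show "x \<in> {1, 2, 3}" by auto
  qed
  then have "P \<in> Pow {1, 2, 3}" by blast
  then show "P \<in> {{3}, {1, 2}}" using sum by (auto simp: Pow_insert)
qed

text \<open>Here doubling the distance to the binary expansion would give 2, which exceeds
  the bound.\<close>

lemma walk_3:
  assumes "P \<in> chained_partitions 3" "Q \<in> chained_partitions 3"
  shows "\<exists>k\<le>1. (P, Q) \<in> parcs (partition_graph 3) ^^ k"
proof (cases "P = Q")
  case False
  have "top_exponent {1, 2} 0 1"
    unfolding top_exponent_def
  proof (intro conjI allI impI)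
    fix a :: nat assume "2 ^ a * 3 ^ 0 \<in> {1, 2::nat}"
    then have "(2::nat) ^ a \<le> 2 ^ 1" by auto
    then show "a \<le> 1" by (rule power_le_imp_le_exp[rotated]) simp
  qed simp
  \<comment> \<open>Transition (A) in row 0 with \<open>a = 1\<close> merges 2 and 1 into 3.\<close>
  then have "transition {1, 2} {3}"
    unfolding transition_def transition_A_def by (intro exI[of _ 0] disjI1 exI[of _ 1]) auto
  moreover have "P = {3} \<and> Q = {1, 2} \<or> P = {1, 2} \<and> Q = {3}"
    using chained_partitions_3 assms False by blast
  ultimately have "(P, Q) \<in> parcs (partition_graph 3)"
    using assms by (auto simp: partition_graph_def)
  then show ?thesis by (intro exI[of _ 1]) simp
qed (auto intro: exI[of _ 0])

text \<open>Two descents are joined at the binary expansion, the second one reversed. The factor 2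
  in the estimate of \<open>move_count\<close> pays for both.\<close>

lemma walk_within_bound:
  assumes U: "U \<ge> 1" and PQ: "P \<in> chained_partitions U" "Q \<in> chained_partitions U"
  shows "\<exists>k. (P, Q) \<in> parcs (partition_graph U) ^^ k \<and>
    real k \<le> (ln (real U))\<^sup>2 / (ln 2 * ln 3)"
proof (cases "U = 3")
  case True
  have "ln 2 * ln 3 \<le> (ln (3::real))\<^sup>2"
    unfolding power2_eq_square by (intro mult_right_mono) auto
  then have bound: "1 \<le> (ln (3::real))\<^sup>2 / (ln 2 * ln 3)" by (subst le_divide_eq_1_pos) auto
  obtain k where k: "k \<le> 1" "(P, Q) \<in> parcs (partition_graph U) ^^ k"
    using walk_3 PQ True by blast
  have "real k \<le> 1" using k(1) by simp
  also have "1 \<le> (ln (real U))\<^sup>2 / (ln 2 * ln 3)" using bound True by simp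
  finally show ?thesis using k(2) by blast
next
  case False
  obtain N f where f: "\<forall>b\<ge>1. \<forall>x. 2 ^ x * 3 ^ b \<le> U \<longrightarrow> x + 2 \<le> 2 * f b"
    and N: "U < 3 ^ Suc N"
    and bound: "2 * ln 2 * ln 3 * real (\<Sum>b=1..N. f b) \<le> (ln (real U))\<^sup>2"
    by (rule move_count[OF U False])
  obtain k l where kl: "k \<le> (\<Sum>b=1..N. f b)" "l \<le> (\<Sum>b=1..N. f b)"
    "(P, binary_partition U) \<in> parcs (partition_graph U) ^^ k"
    "(Q, binary_partition U) \<in> parcs (partition_graph U) ^^ l"
    using walk_to_binary_partition[OF f N PQ(1)] walk_to_binary_partition[OF f N PQ(2)] by blast
  have "(P, Q) \<in> parcs (partition_graph U) ^^ (k + l)"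
    using kl(3) relpow_partition_graph_sym[OF kl(4)] by (auto simp: relpow_add)
  moreover have "real (k + l) \<le> (ln (real U))\<^sup>2 / (ln 2 * ln 3)"
  proof -
    have "real (k + l) \<le> 2 * real (\<Sum>b=1..N. f b)" using kl(1,2) by linarith
    then have "real (k + l) * (ln 2 * ln 3) \<le> 2 * real (\<Sum>b=1..N. f b) * (ln 2 * ln 3)"
      by (intro mult_right_mono) auto
    also have "\<dots> \<le> (ln (real U))\<^sup>2" using bound by (simp add: mult_ac)
    finally show ?thesis by (simp add: pos_le_divide_eq)
  qed
  ultimately show ?thesis by blast
qed

theorem theorem2p4:
  fixes U :: nat
  assumes "U \<ge> 1"
  shows "Digraph_Component.connected (with_proj (partition_graph U)) \<and>
    graph_diameter (with_proj (partition_graph U)) \<le> ereal ((ln (real U))\<^sup>2 / (ln 2 * ln 3))"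
proof
  show "Digraph_Component.connected (with_proj (partition_graph U))"
    using walk_within_bound[OF assms] by (rule connected_and_diameter_le(1))
  show "graph_diameter (with_proj (partition_graph U)) \<le> ereal ((ln (real U))\<^sup>2 / (ln 2 * ln 3))"
    using walk_within_bound[OF assms] by (rule connected_and_diameter_le(2))
qed

end
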